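(* Consider the Gibbs sampler defined in the context, with $K\ge3$, $m'=\min\{m_1,\ldots,m_K\}\ge2$ and $m''=\max\{m_1,\ldots,m_K\}$. Assume that $a_1>3/2$ and let $$\delta_1=\frac1{2a_1+K-2},\qquad \delta_6=\frac{K^2+2Ka_1}{2s_0b_1+K^2+2Ka_1},\qquad \delta_7=\frac1{2(a_1-1)}.$$ Let $\rho_1\in(0,1)$ satisfy $$\left(K+\frac{\delta_6}{\delta_7}\right)\delta_1<\rho_1.$$ Assume also that $5m'>m''$. Fix $c_3\in(0,\min\{b_1,b_2\})$ and fix $\gamma\in(\max\{\rho_1,\delta_6,\delta_7\},1)$. Define $$V_3(\theta,\lambda)=e^{c_3\lambda_\theta}+e^{c_3\lambda_e}+\frac{\delta_7}{K\delta_1\lambda_\theta}+\frac{K\lambda_\theta}{s_0+K\lambda_\theta}(\bar\theta-\bar y)^2.$$ Then, for every current state $(\mu',\theta',\lambda')\in\mathbb{R}\times\mathbb{R}^K\times\mathbb{R}_+^2$, the next state $(\mu,\theta,\lambda)$ of the Gibbs sampler satisfies $$E[V_3(\theta,\lambda)\mid\mu',\theta',\lambda']\le\gamma V_3(\theta',\lambda')+b,$$ where $$b=\left(\frac{b_1}{b_1-c_3}\right)^{a_1+K/2}+\left(\frac{b_2}{b_2-c_3}\right)^{a_2+M/2}+(\delta_6+\delta_7)\left[\frac1{s_0}+(m_0-\bar y)^2+\frac{s^2}{K}\right]+\frac{2b_1\delta_7}{K}.$$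
   Context: Model. $K$ and $m_1,\ldots,m_K$ are positive integers, $M=\sum_{i=1}^K m_i$, and $y=(y_{ij})$, $1\le i\le K$, $1\le j\le m_i$, is fixed real data. $a_1,b_1,a_2,b_2,s_0$ are known positive constants and $m_0\in\mathbb{R}$ is known. $\mathrm{Gamma}(\alpha,\beta)$ has density proportional to $w^{\alpha-1}e^{-w\beta}I(w>0)$. Hierarchical model: given $\theta=(\theta_1,\ldots,\theta_K)^T$ and $\lambda_e$, the $Y_{ij}$ are independent with $Y_{ij}\sim\mathrm{N}(\theta_i,\lambda_e^{-1})$; given $\mu,\lambda_\theta$, the variables $\theta_1,\ldots,\theta_K,\lambda_e$ are independent with $\theta_i\sim\mathrm{N}(\mu,\lambda_\theta^{-1})$ and $\lambda_e\sim\mathrm{Gamma}(a_2,b_2)$; $\mu\sim\mathrm{N}(m_0,s_0^{-1})$ and $\lambda_\theta\sim\mathrm{Gamma}(a_1,b_1)$ are independent. Write $\lambda=(\lambda_\theta,\lambda_e)^T$. Notation: $\bar y_i=m_i^{-1}\sum_{j}y_{ij}$, $\bar y=K^{-1}\sum_{i=1}^K\bar y_i$, $s^2=\sum_{i=1}^K(\bar y_i-\bar y)^2$, $\mathrm{SSE}=\sum_{i,j}(y_{ij}-\bar y_i)^2$, $\bar\theta=K^{-1}\sum_{i=1}^K\theta_i$, $v_1(\theta,\mu)=\sum_{i=1}^K(\theta_i-\mu)^2$, $v_2(\theta)=\sum_{i=1}^K m_i(\theta_i-\bar y_i)^2$. Gibbs sampler. The Markov chain on $(\mu,\theta,\lambda)\in\mathbb{R}\times\mathbb{R}^K\times\mathbb{R}_+^2$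 whose transition $(\mu',\theta',\lambda')\to(\mu,\theta,\lambda)$ has density $k(\mu,\theta,\lambda\mid\mu',\theta',\lambda')=f(\mu\mid\theta',\lambda',y)\left[\prod_{i=1}^K f(\theta_i\mid\mu,\lambda',y)\right]f(\lambda_\theta\mid\theta,\mu,y)f(\lambda_e\mid\theta,\mu,y)$, where the $f$'s are the full conditional densities of the posterior given $Y=y$: $\mu\mid\theta,\lambda,y\sim\mathrm{N}\left(\frac{s_0m_0+K\lambda_\theta\bar\theta}{s_0+K\lambda_\theta},\frac1{s_0+K\lambda_\theta}\right)$, $\theta_i\mid\mu,\lambda,y\sim\mathrm{N}\left(\frac{\lambda_\theta\mu+m_i\lambda_e\bar y_i}{\lambda_\theta+m_i\lambda_e},\frac1{\lambda_\theta+m_i\lambda_e}\right)$, $\lambda_\theta\mid\theta,\mu,y\sim\mathrm{Gamma}\left(\frac K2+a_1,\frac{v_1(\theta,\mu)}2+b_1\right)$, $\lambda_e\mid\theta,\mu,y\sim\mathrm{Gamma}\left(\frac M2+a_2,\frac{v_2(\theta)+\mathrm{SSE}}2+b_2\right)$. *)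

theory Defs
  imports "HOL-Probability.Probability"
begin

text \<open>
  The group index i ranges over {1..K} and the observation index j over {1..m i}. A vector
  theta in R^K is a function on {1..K}, and R^K carries the product of K copies of the
  Lebesgue measure.
\<close>

definition ybar_i :: "(nat \<Rightarrow> nat) \<Rightarrow> (nat \<Rightarrow> nat \<Rightarrow> real) \<Rightarrow> nat \<Rightarrow> real" where
  "ybar_i m y i = (\<Sum>j=1..m i. y i j) / real (m i)"

definition ybar :: "nat \<Rightarrow> (nat \<Rightarrow> nat) \<Rightarrow> (nat \<Rightarrow> nat \<Rightarrow> real) \<Rightarrow> real" where
  "ybar K m y = (\<Sum>i=1..K. ybar_i m y i) / real K"

definition s_sq :: "nat \<Rightarrow> (nat \<Rightarrow> nat) \<Rightarrow> (nat \<Rightarrow> nat \<Rightarrow> real) \<Rightarrow> real" where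
  "s_sq K m y = (\<Sum>i=1..K. (ybar_i m y i - ybar K m y)\<^sup>2)"

definition SSE :: "nat \<Rightarrow> (nat \<Rightarrow> nat) \<Rightarrow> (nat \<Rightarrow> nat \<Rightarrow> real) \<Rightarrow> real" where
  "SSE K m y = (\<Sum>i=1..K. \<Sum>j=1..m i. (y i j - ybar_i m y i)\<^sup>2)"

definition M_total :: "nat \<Rightarrow> (nat \<Rightarrow> nat) \<Rightarrow> nat" where
  "M_total K m = (\<Sum>i=1..K. m i)"

definition theta_bar :: "nat \<Rightarrow> (nat \<Rightarrow> real) \<Rightarrow> real" where
  "theta_bar K \<theta> = (\<Sum>i=1..K. \<theta> i) / real K"

definition v1 :: "nat \<Rightarrow> (nat \<Rightarrow> real) \<Rightarrow> real \<Rightarrow> real" where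
  "v1 K \<theta> \<mu> = (\<Sum>i=1..K. (\<theta> i - \<mu>)\<^sup>2)"

definition v2 :: "nat \<Rightarrow> (nat \<Rightarrow> nat) \<Rightarrow> (nat \<Rightarrow> nat \<Rightarrow> real) \<Rightarrow> (nat \<Rightarrow> real) \<Rightarrow> real" where
  "v2 K m y \<theta> = (\<Sum>i=1..K. real (m i) * (\<theta> i - ybar_i m y i)\<^sup>2)"

definition gamma_density :: "real \<Rightarrow> real \<Rightarrow> real \<Rightarrow> real" where
  "gamma_density \<alpha> \<beta> w =
     (if w > 0 then \<beta> powr \<alpha> / Gamma \<alpha> * w powr (\<alpha> - 1) * exp (- w * \<beta>) else 0)"

text \<open>
  In the library, the second argument of normal_density is the standard deviation, here
  the square root of the reciprocal precision.
\<close>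

definition cond_mu :: "real \<Rightarrow> real \<Rightarrow> nat \<Rightarrow> (nat \<Rightarrow> real) \<Rightarrow> real \<times> real \<Rightarrow> real \<Rightarrow> real" where
  "cond_mu s0 m0 K \<theta> = (\<lambda>(lam_th, lam_e).
     normal_density ((s0 * m0 + real K * lam_th * theta_bar K \<theta>) / (s0 + real K * lam_th))
       (sqrt (1 / (s0 + real K * lam_th))))"

definition cond_theta ::
  "(nat \<Rightarrow> nat) \<Rightarrow> (nat \<Rightarrow> nat \<Rightarrow> real) \<Rightarrow> nat \<Rightarrow> real \<Rightarrow> real \<times> real \<Rightarrow> real \<Rightarrow> real" where
  "cond_theta m y i \<mu> = (\<lambda>(lam_th, lam_e).
     normal_density
       ((lam_th * \<mu> + real (m i) * lam_e * ybar_i m y i) / (lam_th + real (m i) * lam_e))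
       (sqrt (1 / (lam_th + real (m i) * lam_e))))"

definition cond_lambda_theta ::
  "real \<Rightarrow> real \<Rightarrow> nat \<Rightarrow> (nat \<Rightarrow> real) \<Rightarrow> real \<Rightarrow> real \<Rightarrow> real" where
  "cond_lambda_theta a1 b1 K \<theta> \<mu> = gamma_density (real K / 2 + a1) (v1 K \<theta> \<mu> / 2 + b1)"

definition cond_lambda_e ::
  "real \<Rightarrow> real \<Rightarrow> nat \<Rightarrow> (nat \<Rightarrow> nat) \<Rightarrow> (nat \<Rightarrow> nat \<Rightarrow> real) \<Rightarrow> (nat \<Rightarrow> real) \<Rightarrow> real \<Rightarrow> real" where
  "cond_lambda_e a2 b2 K m y \<theta> =
     gamma_density (real (M_total K m) / 2 + a2) ((v2 K m y \<theta> + SSE K m y) / 2 + b2)"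

type_synonym state = "real \<times> (nat \<Rightarrow> real) \<times> (real \<times> real)"

definition state_space :: "nat \<Rightarrow> state set" where
  "state_space K = UNIV \<times> ({1..K} \<rightarrow>\<^sub>E UNIV) \<times> ({0<..} \<times> {0<..})"

text \<open>
  The reference measure puts Lebesgue measure on both coordinates of lambda; the Gamma
  densities vanish off the positive half-line, so the kernel below is carried by the
  state space.
\<close>

definition state_lebesgue :: "nat \<Rightarrow> state measure" where
  "state_lebesgue K = lborel \<Otimes>\<^sub>M (\<Pi>\<^sub>M i\<in>{1..K}. lborel) \<Otimes>\<^sub>M (lborel \<Otimes>\<^sub>M lborel)"

definition gibbs_density ::
  "real \<Rightarrow> real \<Rightarrow> real \<Rightarrow> real \<Rightarrow> real \<Rightarrow> real \<Rightarrow> nat \<Rightarrow> (nat \<Rightarrow> nat) \<Rightarrow> (nat \<Rightarrow> nat \<Rightarrow> real)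
     \<Rightarrow> state \<Rightarrow> state \<Rightarrow> real" where
  "gibbs_density a1 b1 a2 b2 s0 m0 K m y = (\<lambda>(\<mu>', \<theta>', lam') (\<mu>, \<theta>, (lam_th, lam_e)).
     cond_mu s0 m0 K \<theta>' lam' \<mu> * (\<Prod>i=1..K. cond_theta m y i \<mu> lam' (\<theta> i))
       * cond_lambda_theta a1 b1 K \<theta> \<mu> lam_th * cond_lambda_e a2 b2 K m y \<theta> lam_e)"

definition gibbs_kernel ::
  "real \<Rightarrow> real \<Rightarrow> real \<Rightarrow> real \<Rightarrow> real \<Rightarrow> real \<Rightarrow> nat \<Rightarrow> (nat \<Rightarrow> nat) \<Rightarrow> (nat \<Rightarrow> nat \<Rightarrow> real)
     \<Rightarrow> state \<Rightarrow> state measure" where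
  "gibbs_kernel a1 b1 a2 b2 s0 m0 K m y x' =
     density (state_lebesgue K) (\<lambda>x. ennreal (gibbs_density a1 b1 a2 b2 s0 m0 K m y x' x))"

definition V3 ::
  "real \<Rightarrow> real \<Rightarrow> real \<Rightarrow> real \<Rightarrow> nat \<Rightarrow> (nat \<Rightarrow> nat) \<Rightarrow> (nat \<Rightarrow> nat \<Rightarrow> real)
     \<Rightarrow> (nat \<Rightarrow> real) \<Rightarrow> real \<times> real \<Rightarrow> real" where
  "V3 c3 \<delta>1 \<delta>7 s0 K m y \<theta> = (\<lambda>(lam_th, lam_e).
     exp (c3 * lam_th) + exp (c3 * lam_e) + \<delta>7 / (real K * \<delta>1 * lam_th)
       + real K * lam_th / (s0 + real K * lam_th) * (theta_bar K \<theta> - ybar K m y)\<^sup>2)"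

end

theory Submission
  imports Defs
begin

text \<open>
  The next state is drawn in the order mu, theta, lambda, so the expectation is computed from
  the inside out. In the lambda-integral the exponential terms are explicit Gamma moment
  generating functions, decreasing in the rate, and E(1/lambda_theta) is linear in v1. By
  concavity of x / (s0 + x), the last term of V3 has conditional mean at most
  delta6 (thetabar - ybar)^2. Given mu, put w_i = m_i lambda_e' / (lambda_theta' + m_i lambda_e');
  then theta_i - mu has mean w_i (ybar_i - mu), theta_i - ybar_i has mean
  (1 - w_i) (mu - ybar_i), and all variances are at most 1 / lambda_theta'. The variances
  contribute (K + delta6 / delta7) delta1 times the third term of V3. As
  delta7 w^2 + delta6 (1 - w)^2 \<le> max delta7 delta6 for w in [0,1], the squared means
  contribute at most max delta7 delta6 times (mu - ybar)^2 + s^2 / K. Finally the conditional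
  mean of mu is a convex combination of m0 and thetabar', with weight
  K lambda_theta' / (s0 + K lambda_theta') on thetabar', which reproduces the last term of V3.
\<close>

section \<open>Moments of Gamma and normal densities\<close>

lemma gamma_density_nonneg: "0 < \<alpha> \<Longrightarrow> 0 \<le> gamma_density \<alpha> \<beta> w"
  by (simp add: gamma_density_def Gamma_real_pos less_imp_le)

lemma borel_measurable_gamma_density [measurable]:
  assumes [measurable]: "f \<in> borel_measurable M" "g \<in> borel_measurable M"
  shows "(\<lambda>x. gamma_density \<alpha> (f x) (g x)) \<in> borel_measurable M"
  unfolding gamma_density_def by measurable

text \<open>The substitution \<open>t = \<beta> * w\<close> turns Euler's integral for
  \<open>Gamma \<alpha>\<close> into \<open>Gamma \<alpha>\<close> times the mass of the density;
  this constant is positive and finite, so it cancels.\<close>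

lemma nn_integral_gamma_density:
  assumes "0 < \<alpha>" "0 < \<beta>"
  shows "(\<integral>\<^sup>+ w. ennreal (gamma_density \<alpha> \<beta> w) \<partial>lborel) = 1"
proof -
  have G: "0 < Gamma \<alpha>" using assms by (simp add: Gamma_real_pos)
  let ?f = "\<lambda>t. ennreal (indicator {0..} t * t powr (\<alpha> - 1) / exp t)"
  have "ennreal (Gamma \<alpha>) = (\<integral>\<^sup>+ t. ?f t \<partial>lborel)"
    by (rule Gamma_conv_nn_integral_real[OF assms(1)])
  also have "\<dots> = ennreal \<bar>\<beta>\<bar> * (\<integral>\<^sup>+ w. ?f (0 + \<beta> * w) \<partial>lborel)"
    using assms by (intro nn_integral_real_affine) auto
  also have "\<dots> = (\<integral>\<^sup>+ w. ennreal (Gamma \<alpha>) * ennreal (gamma_density \<alpha> \<beta> w) \<partial>lborel)"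
    apply (subst nn_integral_cmult[symmetric])
     apply measurable
    apply (rule nn_integral_cong)
    subgoal for w
    proof (cases "w > 0")
      case True
      then have "\<beta> * (indicator {0..} (\<beta> * w) * (\<beta> * w) powr (\<alpha> - 1) / exp (\<beta> * w))
          = Gamma \<alpha> * gamma_density \<alpha> \<beta> w"
        using assms G less_imp_neq[OF G] by (simp add: gamma_density_def powr_mult powr_diff exp_minus field_simps)
      then show ?thesis
        using assms G True by (simp add: ennreal_mult'[symmetric])
    next
      case False
      \<comment> \<open>At \<open>w = 0\<close> the indicator of \<open>{0..}\<close> is 1, but
        \<open>0 powr _\<close> is 0, so the two integrands still agree there.\<close>
      then show ?thesis using assms
        by (cases "w = 0") (auto simp: gamma_density_def indicator_def zero_le_mult_iff)
    qed
    done
  also have "\<dots> = ennreal (Gamma \<alpha>) * (\<integral>\<^sup>+ w. ennreal (gamma_density \<alpha> \<beta> w) \<partial>lborel)"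
    by (intro nn_integral_cmult) measurable
  finally have "ennreal (Gamma \<alpha>) * (\<integral>\<^sup>+ w. ennreal (gamma_density \<alpha> \<beta> w) \<partial>lborel) 
      = ennreal (Gamma \<alpha>) * 1" by simp
  then show ?thesis
    unfolding ennreal_mult_cancel_left using G by auto
qed

lemma has_bochner_integral_gamma_density:
  assumes "0 < \<alpha>" "0 < \<beta>"
  shows "has_bochner_integral lborel (gamma_density \<alpha> \<beta>) 1"
  using assms
  by (intro has_bochner_integral_nn_integral) (auto simp: gamma_density_nonneg nn_integral_gamma_density)

text \<open>Exponential tilting: the factor \<open>exp (c * w)\<close> lowers the rate from \<beta>
  to \<open>\<beta> - c\<close>, and the ratio of the normalising constants is the value of the
  integral.\<close>

lemma gamma_density_mgf:
  assumes "0 < \<alpha>" "c < \<beta>" "0 < \<beta>"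
  shows "has_bochner_integral lborel (\<lambda>w. gamma_density \<alpha> \<beta> w * exp (c * w)) ((\<beta> / (\<beta> - c)) powr \<alpha>)"
proof -
  have "gamma_density \<alpha> \<beta> w * exp (c * w) = gamma_density \<alpha> (\<beta> - c) w * (\<beta> / (\<beta> - c)) powr \<alpha>" for w
    using assms by (simp add: gamma_density_def powr_divide algebra_simps flip: exp_add)
  moreover have "has_bochner_integral lborel (\<lambda>w. gamma_density \<alpha> (\<beta> - c) w * (\<beta> / (\<beta> - c)) powr \<alpha>)
      (1 * (\<beta> / (\<beta> - c)) powr \<alpha>)"
    using assms by (intro has_bochner_integral_mult_left has_bochner_integral_gamma_density) auto
  ultimately show ?thesis by simp
qed

text \<open>Multiplying by \<open>w\<close> raises the shape by one, and the functional equation of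
  \<open>Gamma\<close> supplies the constant.\<close>

lemma gamma_density_mean:
  assumes "0 < \<alpha>" "0 < \<beta>"
  shows "has_bochner_integral lborel (\<lambda>w. gamma_density \<alpha> \<beta> w * w) (\<alpha> / \<beta>)"
proof -
  have "gamma_density \<alpha> \<beta> w * w = gamma_density (\<alpha> + 1) \<beta> w * (\<alpha> / \<beta>)" for w
    using assms Gamma_plus1[of \<alpha>] nonpos_Ints_nonpos[of \<alpha>]
    by (cases "\<alpha> \<in> \<int>\<^sub>\<le>\<^sub>0") (auto simp: gamma_density_def powr_add powr_diff)
  moreover have "has_bochner_integral lborel (\<lambda>w. gamma_density (\<alpha> + 1) \<beta> w * (\<alpha> / \<beta>)) (1 * (\<alpha> / \<beta>))"
    using assms by (intro has_bochner_integral_mult_left has_bochner_integral_gamma_density) auto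
  ultimately show ?thesis by simp
qed

text \<open>Dividing by \<open>w\<close> lowers the shape by one, and \<open>1 < \<alpha>\<close>
  keeps the new shape positive. This controls the reciprocal precision term of
  \<open>V3\<close>.\<close>

lemma gamma_density_inverse_mean:
  assumes "1 < \<alpha>" "0 < \<beta>"
  shows "has_bochner_integral lborel (\<lambda>w. gamma_density \<alpha> \<beta> w / w) (\<beta> / (\<alpha> - 1))"
proof -
  have "Gamma \<alpha> = (\<alpha> - 1) * Gamma (\<alpha> - 1)"
    using assms Gamma_plus1[of "\<alpha> - 1"] nonpos_Ints_nonpos[of "\<alpha> - 1"] by auto
  then have "gamma_density \<alpha> \<beta> w / w = gamma_density (\<alpha> - 1) \<beta> w * (\<beta> / (\<alpha> - 1))" for w
    using assms by (auto simp: gamma_density_def powr_diff mult_ac power2_eq_square)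
  moreover have "has_bochner_integral lborel (\<lambda>w. gamma_density (\<alpha> - 1) \<beta> w * (\<beta> / (\<alpha> - 1))) (1 * (\<beta> / (\<alpha> - 1)))"
    using assms by (intro has_bochner_integral_mult_left has_bochner_integral_gamma_density) auto
  ultimately show ?thesis by simp
qed

section \<open>Second moments under products of normal densities\<close>

lemma has_bochner_integral_PiM_prod:
  fixes f :: "'i \<Rightarrow> real \<Rightarrow> real"
  assumes "finite I" "\<And>i. i \<in> I \<Longrightarrow> has_bochner_integral lborel (f i) (v i)"
  shows "has_bochner_integral (\<Pi>\<^sub>M i\<in>I. lborel) (\<lambda>x. \<Prod>i\<in>I. f i (x i)) (\<Prod>i\<in>I. v i)"
proof -
  interpret product_sigma_finite "\<lambda>i::'i. lborel :: real measure" ..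
  have "integrable lborel (f i)" "integral\<^sup>L lborel (f i) = v i" if "i \<in> I" for i
    using assms(2)[OF that] by (auto simp: has_bochner_integral_iff)
  then show ?thesis
    using assms(1) by (simp add: has_bochner_integral_iff product_integrable_prod product_integral_prod)
qed

lemma normal_density_moments:
  assumes "0 < \<sigma>"
  shows "has_bochner_integral lborel (normal_density c \<sigma>) 1"
    and "has_bochner_integral lborel (\<lambda>x. normal_density c \<sigma> x * (x - c)) 0"
    and "has_bochner_integral lborel (\<lambda>x. normal_density c \<sigma> x * (x - c)\<^sup>2) (\<sigma>\<^sup>2)"
  using normal_moment_even[OF assms, of c 0] normal_moment_odd[OF assms, of c 0]
    normal_moment_even[OF assms, of c 1] by simp_all

text \<open>The integrand is a product of functions of single coordinates, so the integral factors.
  For \<open>i \<noteq> j\<close> a centred first moment makes the product vanish; for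
  \<open>i = j\<close> that coordinate carries the variance.\<close>

lemma normal_PiM_covariance:
  fixes c \<sigma> :: "'i \<Rightarrow> real"
  assumes I: "finite I" "i \<in> I" "j \<in> I" and \<sigma>: "\<And>i. i \<in> I \<Longrightarrow> 0 < \<sigma> i"
  shows "has_bochner_integral (\<Pi>\<^sub>M i\<in>I. lborel)
    (\<lambda>x. (\<Prod>k\<in>I. normal_density (c k) (\<sigma> k) (x k)) * ((x i - c i) * (x j - c j)))
    (if i = j then (\<sigma> i)\<^sup>2 else 0)"
proof -
  \<comment> \<open>The two conditionals place the factor \<open>t - c k\<close> at the coordinates
    \<open>i\<close> and \<open>j\<close>; if these coincide, both apply and produce its
    square.\<close>
  let ?f = "\<lambda>k t. normal_density (c k) (\<sigma> k) t * ((if k = i then t - c k else 1) * (if k = j then t - c k else 1))"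
  let ?v = "\<lambda>k. (if k = i then (if i = j then (\<sigma> i)\<^sup>2 else 0) else if k = j then 0 else 1)"
  have "has_bochner_integral (\<Pi>\<^sub>M i\<in>I. lborel) (\<lambda>x. \<Prod>k\<in>I. ?f k (x k)) (\<Prod>k\<in>I. ?v k)"
    using \<sigma> normal_density_moments[of "\<sigma> _" "c _"]
    by (intro has_bochner_integral_PiM_prod I) (auto simp: power2_eq_square)
  moreover have "(\<Prod>k\<in>I. ?v k) = (if i = j then (\<sigma> i)\<^sup>2 else 0)"
  proof (cases "i = j")
    case True
    then have "(\<Prod>k\<in>I. ?v k) = (\<Prod>k\<in>I. if k = i then (\<sigma> i)\<^sup>2 else 1)"
      by (intro prod.cong) auto
    then show ?thesis using I True by simp
  qed (use I in \<open>auto intro!: prod_zero bexI[of _ i]\<close>)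
  moreover have "(\<Prod>k\<in>I. ?f k (x k)) = (\<Prod>k\<in>I. normal_density (c k) (\<sigma> k) (x k)) * ((x i - c i) * (x j - c j))" for x
    using I by (simp add: prod.distrib)
  ultimately show ?thesis by simp
qed

lemma normal_PiM_centered:
  fixes c \<sigma> :: "'i \<Rightarrow> real"
  assumes I: "finite I" "i \<in> I" and \<sigma>: "\<And>i. i \<in> I \<Longrightarrow> 0 < \<sigma> i"
  shows "has_bochner_integral (\<Pi>\<^sub>M i\<in>I. lborel)
    (\<lambda>x. (\<Prod>k\<in>I. normal_density (c k) (\<sigma> k) (x k)) * (x i - c i)) 0"
proof -
  let ?f = "\<lambda>k t. normal_density (c k) (\<sigma> k) t * (if k = i then t - c k else 1)"
  have "has_bochner_integral (\<Pi>\<^sub>M i\<in>I. lborel) (\<lambda>x. \<Prod>k\<in>I. ?f k (x k)) (\<Prod>k\<in>I. if k = i then 0 else 1)"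
    using \<sigma> normal_density_moments[of "\<sigma> _" "c _"]
    by (intro has_bochner_integral_PiM_prod I) auto
  then show ?thesis
    using I by (simp add: prod.distrib)
qed

text \<open>Variance plus squared mean. Suitable \<open>a\<close> and \<open>r\<close> give the
  total mass, the square of one shifted coordinate and the square of a shifted average.\<close>

lemma normal_PiM_affine_square:
  fixes c \<sigma> a :: "'i \<Rightarrow> real"
  assumes I: "finite I" and \<sigma>: "\<And>i. i \<in> I \<Longrightarrow> 0 < \<sigma> i"
  shows "has_bochner_integral (\<Pi>\<^sub>M i\<in>I. lborel)
    (\<lambda>x. (\<Prod>k\<in>I. normal_density (c k) (\<sigma> k) (x k)) * ((\<Sum>i\<in>I. a i * x i) + r)\<^sup>2)
    ((\<Sum>i\<in>I. (a i)\<^sup>2 * (\<sigma> i)\<^sup>2) + ((\<Sum>i\<in>I. a i * c i) + r)\<^sup>2)"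
proof -
  define D where "D x = (\<Prod>k\<in>I. normal_density (c k) (\<sigma> k) (x k))" for x
  \<comment> \<open>\<open>r'\<close> is the mean of the affine form. Expanding around it leaves a
    double sum of covariances, a linear part with mean zero and a constant.\<close>
  define r' where "r' = (\<Sum>i\<in>I. a i * c i) + r"
  have D: "has_bochner_integral (\<Pi>\<^sub>M i\<in>I. lborel) D 1"
    using has_bochner_integral_PiM_prod[OF I, of "\<lambda>k. normal_density (c k) (\<sigma> k)" "\<lambda>_. 1"]
      \<sigma> normal_density_moments(1) unfolding D_def by auto
  have "has_bochner_integral (\<Pi>\<^sub>M i\<in>I. lborel)
     (\<lambda>x. (\<Sum>i\<in>I. \<Sum>j\<in>I. a i * a j * (D x * ((x i - c i) * (x j - c j))))
        + (\<Sum>i\<in>I. (2 * r' * a i) * (D x * (x i - c i))) + r'\<^sup>2 * D x)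
     ((\<Sum>i\<in>I. \<Sum>j\<in>I. a i * a j * (if i = j then (\<sigma> i)\<^sup>2 else 0))
        + (\<Sum>i\<in>I. (2 * r' * a i) * 0) + r'\<^sup>2 * 1)"
    using I \<sigma> D normal_PiM_covariance[of I _ _ \<sigma> c, folded D_def]
      normal_PiM_centered[of I _ \<sigma> c, folded D_def]
    by (intro has_bochner_integral_add has_bochner_integral_sum has_bochner_integral_mult_right) auto
  moreover have "(\<Sum>i\<in>I. \<Sum>j\<in>I. a i * a j * (D x * ((x i - c i) * (x j - c j))))
        + (\<Sum>i\<in>I. (2 * r' * a i) * (D x * (x i - c i))) + r'\<^sup>2 * D x
      = D x * ((\<Sum>i\<in>I. a i * x i) + r)\<^sup>2" for x
  proof -
    let ?S = "\<Sum>i\<in>I. a i * (x i - c i)"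
    have "(\<Sum>i\<in>I. a i * x i) + r = ?S + r'"
      by (simp add: r'_def right_diff_distrib sum_subtractf)
    moreover have "(\<Sum>i\<in>I. \<Sum>j\<in>I. a i * a j * (D x * ((x i - c i) * (x j - c j)))) = D x * (?S * ?S)"
      by (simp add: sum_product sum_distrib_left mult_ac)
    moreover have "(\<Sum>i\<in>I. (2 * r' * a i) * (D x * (x i - c i))) = D x * (2 * r' * ?S)"
      unfolding sum_distrib_left by (intro sum.cong refl) (simp add: mult_ac)
    ultimately show ?thesis by (simp add: power2_eq_square algebra_simps)
  qed
  moreover have "(\<Sum>i\<in>I. \<Sum>j\<in>I. a i * a j * (if i = j then (\<sigma> i)\<^sup>2 else 0)) = (\<Sum>i\<in>I. (a i)\<^sup>2 * (\<sigma> i)\<^sup>2)"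
    using I by (simp add: if_distrib[of "\<lambda>x. _ * x"] power2_eq_square cong: if_cong)
  ultimately show ?thesis by (simp add: D_def r'_def)
qed

section \<open>The three conditional updates\<close>

lemma nn_integral_has_bochner:
  fixes f :: "'a \<Rightarrow> real"
  assumes "has_bochner_integral M f v" "\<And>x. 0 \<le> f x"
  shows "(\<integral>\<^sup>+ x. ennreal (f x) \<partial>M) = ennreal v"
  using assms by (simp add: has_bochner_integral_iff nn_integral_eq_integral)

lemma normal_density_affine_square:
  assumes "0 < \<sigma>"
  shows "has_bochner_integral lborel (\<lambda>x. normal_density c \<sigma> x * (A + d * (x - r)\<^sup>2)) (A + d * (\<sigma>\<^sup>2 + (c - r)\<^sup>2))"
proof -
  note M = normal_density_moments[OF assms, of c]
  have "has_bochner_integral lborel (\<lambda>x. (A + d * (c - r)\<^sup>2) * normal_density c \<sigma> x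
      + (2 * d * (c - r)) * (normal_density c \<sigma> x * (x - c)) + d * (normal_density c \<sigma> x * (x - c)\<^sup>2))
    ((A + d * (c - r)\<^sup>2) * 1 + (2 * d * (c - r)) * 0 + d * \<sigma>\<^sup>2)"
    by (intro has_bochner_integral_add has_bochner_integral_mult_right M)
  moreover have "(A + d * (c - r)\<^sup>2) * normal_density c \<sigma> x
      + (2 * d * (c - r)) * (normal_density c \<sigma> x * (x - c)) + d * (normal_density c \<sigma> x * (x - c)\<^sup>2)
      = normal_density c \<sigma> x * (A + d * (x - r)\<^sup>2)" for x
    by (simp add: power2_eq_square algebra_simps)
  ultimately show ?thesis by (simp add: algebra_simps)
qed

text \<open>The right-hand side is the tangent line at \<open>x0\<close> of the concave map
  \<open>x / (s + x)\<close>. After clearing denominators the gap is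
  \<open>s * (x - x0)\<^sup>2\<close>.\<close>

lemma saturation_tangent:
  fixes s x x0 :: real
  assumes "0 < s" "0 \<le> x" "0 \<le> x0"
  shows "x / (s + x) \<le> (x0 / (s + x0))\<^sup>2 + s / (s + x0)\<^sup>2 * x"
proof -
  have "(x0\<^sup>2 + s * x) * (s + x) - x * (s + x0)\<^sup>2 = s * (x - x0)\<^sup>2"
    by (simp add: power2_eq_square algebra_simps)
  moreover have "0 \<le> s * (x - x0)\<^sup>2" using assms by simp
  ultimately have "x * (s + x0)\<^sup>2 \<le> (x0\<^sup>2 + s * x) * (s + x)" by linarith
  then have "x / (s + x) \<le> (x0\<^sup>2 + s * x) / (s + x0)\<^sup>2"
    using assms by (intro mult_imp_div_pos_le) (auto simp: pos_le_divide_eq)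
  then show ?thesis by (simp add: add_divide_distrib power_divide)
qed

lemma saturation_mono:
  fixes s x x0 :: real
  assumes "0 < s" "0 \<le> x" "x \<le> x0"
  shows "x / (s + x) \<le> x0 / (s + x0)"
  using assms by (simp add: divide_simps) (simp add: algebra_simps)

text \<open>The integrals of the exponential and reciprocal terms are exact. Only the saturating
  ratio is estimated: its tangent line is affine in \<open>l\<close>, so the mean of the Gamma law
  suffices, which is Jensen's inequality by hand.\<close>

lemma gamma_update_bound:
  assumes \<alpha>: "1 < \<alpha>1" "0 < \<alpha>2" and \<beta>: "c < \<beta>1" "c < \<beta>2" "0 < \<beta>1" "0 < \<beta>2"
    and nn: "0 \<le> C" "0 \<le> q" "0 \<le> k" "0 < s"
  shows "(\<integral>\<^sup>+ l. \<integral>\<^sup>+ e. ennreal (gamma_density \<alpha>1 \<beta>1 l * gamma_density \<alpha>2 \<beta>2 e *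
      (exp (c * l) + exp (c * e) + C / l + k * l / (s + k * l) * q)) \<partial>lborel \<partial>lborel)
    \<le> ennreal ((\<beta>1 / (\<beta>1 - c)) powr \<alpha>1 + (\<beta>2 / (\<beta>2 - c)) powr \<alpha>2 + C * (\<beta>1 / (\<alpha>1 - 1))
        + k * (\<alpha>1 / \<beta>1) / (s + k * (\<alpha>1 / \<beta>1)) * q)"
proof -
  let ?g1 = "gamma_density \<alpha>1 \<beta>1" and ?g2 = "gamma_density \<alpha>2 \<beta>2"
  \<comment> \<open>The tangent is taken at \<open>k\<close> times the mean
    \<open>\<alpha>1 / \<beta>1\<close> of \<open>l\<close>.\<close>
  define x0 where "x0 = k * (\<alpha>1 / \<beta>1)"
  define B2 where "B2 = (\<beta>2 / (\<beta>2 - c)) powr \<alpha>2"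
  have x0: "0 \<le> x0" using \<alpha> \<beta> nn by (simp add: x0_def)
  define A where "A l = exp (c * l) + C / l + k * l / (s + k * l) * q" for l
  have inner: "(\<integral>\<^sup>+ e. ennreal (?g1 l * ?g2 e * (exp (c * l) + exp (c * e) + C / l + k * l / (s + k * l) * q)) \<partial>lborel)
      = ennreal (?g1 l * (A l + B2))" for l
  \<comment> \<open>The sign of \<open>C / l\<close> is under control only for positive
    \<open>l\<close>; elsewhere the density is 0 and both sides vanish.\<close>
  proof (cases "0 < l")
    case True
    have "has_bochner_integral lborel (\<lambda>e. ?g1 l * (A l * ?g2 e + ?g2 e * exp (c * e))) (?g1 l * (A l * 1 + B2))"
      unfolding B2_def using \<alpha> \<beta>
      by (intro has_bochner_integral_mult_right has_bochner_integral_add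
          has_bochner_integral_gamma_density gamma_density_mgf) auto
    moreover have "0 \<le> ?g1 l * (A l * ?g2 e + ?g2 e * exp (c * e))" for e
      using True \<alpha> nn by (auto intro!: mult_nonneg_nonneg add_nonneg_nonneg simp: A_def gamma_density_nonneg)
    ultimately have "(\<integral>\<^sup>+ e. ennreal (?g1 l * (A l * ?g2 e + ?g2 e * exp (c * e))) \<partial>lborel) = ennreal (?g1 l * (A l * 1 + B2))"
      by (rule nn_integral_has_bochner)
    moreover have "?g1 l * (A l * ?g2 e + ?g2 e * exp (c * e))
       = ?g1 l * ?g2 e * (exp (c * l) + exp (c * e) + C / l + k * l / (s + k * l) * q)" for e
      by (simp add: A_def algebra_simps)
    ultimately show ?thesis by simp
  qed (simp add: gamma_density_def)
  let ?p0 = "(x0 / (s + x0))\<^sup>2" and ?p1 = "s / (s + x0)\<^sup>2 * k"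
  let ?U = "\<lambda>l. ?g1 l * exp (c * l) + C * (?g1 l / l) + (q * ?p0 + B2) * ?g1 l + (q * ?p1) * (?g1 l * l)"
  have U: "has_bochner_integral lborel ?U ((\<beta>1 / (\<beta>1 - c)) powr \<alpha>1 + C * (\<beta>1 / (\<alpha>1 - 1))
      + (q * ?p0 + B2) * 1 + (q * ?p1) * (\<alpha>1 / \<beta>1))"
    using \<alpha> \<beta>
    by (intro has_bochner_integral_add has_bochner_integral_mult_right gamma_density_mgf gamma_density_mean
        gamma_density_inverse_mean has_bochner_integral_gamma_density) auto
  have U0: "0 \<le> ?U l" for l
  proof (cases "0 < l")
    case True
    then show ?thesis using \<alpha> nn x0
      by (auto intro!: mult_nonneg_nonneg add_nonneg_nonneg divide_nonneg_nonneg simp: gamma_density_nonneg B2_def)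
  qed (simp add: gamma_density_def)
  have le: "?g1 l * (A l + B2) \<le> ?U l" for l
  proof (cases "0 < l")
    case True
    then have "k * l / (s + k * l) \<le> ?p0 + s / (s + x0)\<^sup>2 * (k * l)"
      using nn x0 by (intro saturation_tangent) auto
    then have "k * l / (s + k * l) * q \<le> (?p0 + ?p1 * l) * q"
      using nn by (intro mult_right_mono) (auto simp: mult_ac)
    then have "?g1 l * (A l + B2) \<le> ?g1 l * (exp (c * l) + C / l + (?p0 + ?p1 * l) * q + B2)"
      using \<alpha> by (intro mult_left_mono) (auto simp: A_def gamma_density_nonneg)
    then show ?thesis by (simp add: algebra_simps)
  qed (simp add: gamma_density_def)
  \<comment> \<open>At its point of contact the tangent line takes the value of the ratio
    itself.\<close>
  have "?p0 + ?p1 * (\<alpha>1 / \<beta>1) = (x0\<^sup>2 + s * x0) / (s + x0)\<^sup>2"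
    by (simp add: power_divide add_divide_distrib) (simp add: x0_def mult_ac)
  also have "\<dots> = x0 / (s + x0)"
    using nn x0 by (simp add: power2_eq_square flip: distrib_right) (simp add: add_ac)
  finally have p: "?p0 + ?p1 * (\<alpha>1 / \<beta>1) = x0 / (s + x0)" .
  have "(q * ?p0 + B2) * 1 + (q * ?p1) * (\<alpha>1 / \<beta>1) = B2 + (?p0 + ?p1 * (\<alpha>1 / \<beta>1)) * q"
    by (simp add: algebra_simps)
  then have val: "(q * ?p0 + B2) * 1 + (q * ?p1) * (\<alpha>1 / \<beta>1) = B2 + x0 / (s + x0) * q"
    unfolding p .
  have "(\<integral>\<^sup>+ l. ennreal (?g1 l * (A l + B2)) \<partial>lborel) \<le> (\<integral>\<^sup>+ l. ennreal (?U l) \<partial>lborel)"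
    by (intro nn_integral_mono ennreal_leI le)
  also have "\<dots> = ennreal ((\<beta>1 / (\<beta>1 - c)) powr \<alpha>1 + C * (\<beta>1 / (\<alpha>1 - 1)) + ((q * ?p0 + B2) * 1 + (q * ?p1) * (\<alpha>1 / \<beta>1)))"
    using nn_integral_has_bochner[OF U U0] by (simp only: add.assoc)
  finally show ?thesis
    unfolding inner val by (simp add: x0_def B2_def add_ac)
qed

text \<open>Expand around the average of the \<open>x i\<close>: the cross term vanishes because
  deviations from the average sum to zero.\<close>

lemma sum_sq_deviation:
  fixes x :: "nat \<Rightarrow> real"
  assumes "0 < K"
  shows "(\<Sum>i=1..K. (t - x i)\<^sup>2) = real K * (t - (\<Sum>i=1..K. x i) / real K)\<^sup>2
    + (\<Sum>i=1..K. (x i - (\<Sum>i=1..K. x i) / real K)\<^sup>2)"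
proof -
  define z where "z = (\<Sum>i=1..K. x i) / real K"
  have z: "(\<Sum>i=1..K. x i) = real K * z" using assms by (simp add: z_def)
  have "(\<Sum>i=1..K. (t - x i)\<^sup>2) = (\<Sum>i=1..K. (t - z)\<^sup>2 + (x i - z)\<^sup>2 + (2 * (z - t)) * (x i - z))"
    by (intro sum.cong) (auto simp: power2_eq_square algebra_simps)
  also have "\<dots> = real K * (t - z)\<^sup>2 + (\<Sum>i=1..K. (x i - z)\<^sup>2) + (2 * (z - t)) * (\<Sum>i=1..K. x i - z)"
    by (simp add: sum.distrib sum_distrib_left)
  also have "(\<Sum>i=1..K. x i - z) = 0" using z by (simp add: sum_subtractf)
  finally show ?thesis by (simp add: z_def)
qed

text \<open>On the unit interval squaring does not increase \<open>w\<close> or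
  \<open>1 - w\<close>, so the left side is at most a convex combination of \<open>d\<close> and
  \<open>e\<close>.\<close>

lemma convex_square_weights:
  fixes w d e :: real
  assumes "0 \<le> w" "w \<le> 1" "0 \<le> d" "0 \<le> e"
  shows "d * w\<^sup>2 + e * (1 - w)\<^sup>2 \<le> max d e"
proof -
  have "d * w\<^sup>2 + e * (1 - w)\<^sup>2 \<le> max d e * w + max d e * (1 - w)"
    using assms by (intro add_mono mult_mono) (auto simp: power2_eq_square mult_le_one mult_left_le)
  then show ?thesis by (simp add: algebra_simps)
qed

text \<open>Here \<open>c i\<close> and \<open>v i\<close> stand for the conditional mean and
  variance of the i-th coordinate, and \<open>w i\<close> for the weight on the group mean
  \<open>x i\<close>. Both squared biases are controlled by the same quantities
  \<open>(\<mu> - x i)\<^sup>2\<close>, with weights \<open>(w i)\<^sup>2\<close> and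
  \<open>(1 - w i)\<^sup>2\<close>; combining them before estimating yields \<open>max d d'\<close>
  instead of \<open>d + d'\<close>.\<close>

lemma theta_moment_bound:
  fixes x w v :: "nat \<Rightarrow> real"
  assumes K: "0 < K" and d: "0 \<le> d" "0 \<le> d'" and p: "0 < p"
    and w: "\<And>i. i \<in> {1..K} \<Longrightarrow> 0 \<le> w i \<and> w i \<le> 1"
    and v: "\<And>i. i \<in> {1..K} \<Longrightarrow> v i \<le> 1 / p"
    and c: "\<And>i. i \<in> {1..K} \<Longrightarrow> c i = (1 - w i) * \<mu> + w i * x i"
  defines "z \<equiv> (\<Sum>i=1..K. x i) / real K"
  shows "d / real K * (\<Sum>i=1..K. v i + (c i - \<mu>)\<^sup>2)
      + d' * ((\<Sum>i=1..K. (1 / real K)\<^sup>2 * v i) + ((\<Sum>i=1..K. c i) / real K - z)\<^sup>2)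
    \<le> (d + d' / real K) / p + max d d' * ((\<mu> - z)\<^sup>2 + (\<Sum>i=1..K. (x i - z)\<^sup>2) / real K)"
proof -
  have sv: "sum v {1..K} \<le> real K / p"
    using sum_mono[of "{1..K}" v "\<lambda>_. 1 / p"] v by simp
  have c\<mu>: "(\<Sum>i=1..K. (c i - \<mu>)\<^sup>2) = (\<Sum>i=1..K. (w i)\<^sup>2 * (\<mu> - x i)\<^sup>2)"
  proof (intro sum.cong refl)
    fix i assume "i \<in> {1..K}"
    then have "c i - \<mu> = - (w i * (\<mu> - x i))" using c by (simp add: algebra_simps)
    then show "(c i - \<mu>)\<^sup>2 = (w i)\<^sup>2 * (\<mu> - x i)\<^sup>2" by (simp add: power_mult_distrib)
  qed
  have "(\<Sum>i=1..K. c i) / real K - z = (\<Sum>i=1..K. (1 - w i) * (\<mu> - x i)) / real K"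
  proof -
    have "(\<Sum>i=1..K. c i - x i) = (\<Sum>i=1..K. (1 - w i) * (\<mu> - x i))"
      using c by (intro sum.cong) (auto simp: algebra_simps)
    then show ?thesis by (simp add: z_def sum_subtractf flip: diff_divide_distrib)
  qed
  \<comment> \<open>Cauchy-Schwarz: the square of an average is at most the average of the
    squares.\<close>
  also have "\<dots>\<^sup>2 \<le> (\<Sum>i=1..K. (1 - w i)\<^sup>2 * (\<mu> - x i)\<^sup>2) / real K"
    using sum_squared_le_sum_of_squares[of "\<lambda>i. (1 - w i) * (\<mu> - x i)" "{1..K}"] K
    by (simp add: power_divide power_mult_distrib field_simps power2_eq_square)
  finally have cz: "((\<Sum>i=1..K. c i) / real K - z)\<^sup>2 \<le> (\<Sum>i=1..K. (1 - w i)\<^sup>2 * (\<mu> - x i)\<^sup>2) / real K" .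
  have "d / real K * (\<Sum>i=1..K. v i + (c i - \<mu>)\<^sup>2)
      + d' * ((\<Sum>i=1..K. (1 / real K)\<^sup>2 * v i) + ((\<Sum>i=1..K. c i) / real K - z)\<^sup>2)
    \<le> d / real K * (real K / p + (\<Sum>i=1..K. (w i)\<^sup>2 * (\<mu> - x i)\<^sup>2))
      + d' * ((1 / real K)\<^sup>2 * (real K / p) + (\<Sum>i=1..K. (1 - w i)\<^sup>2 * (\<mu> - x i)\<^sup>2) / real K)"
    using d K sv cz unfolding sum.distrib c\<mu> sum_distrib_left[symmetric]
    by (intro add_mono mult_left_mono) auto
  also have "\<dots> = (d + d' / real K) / p
      + (\<Sum>i=1..K. (d * (w i)\<^sup>2 + d' * (1 - w i)\<^sup>2) * (\<mu> - x i)\<^sup>2) / real K"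
    using K p by (simp add: distrib_right sum.distrib mult.assoc power2_eq_square
        distrib_left flip: sum_distrib_left) (simp add: field_simps)
  also have "\<dots> \<le> (d + d' / real K) / p + (\<Sum>i=1..K. max d d' * (\<mu> - x i)\<^sup>2) / real K"
    using w d by (intro add_left_mono divide_right_mono sum_mono mult_right_mono convex_square_weights) auto
  also have "(\<Sum>i=1..K. max d d' * (\<mu> - x i)\<^sup>2) / real K
      = max d d' * ((\<mu> - z)\<^sup>2 + (\<Sum>i=1..K. (x i - z)\<^sup>2) / real K)"
    using K unfolding sum_distrib_left[symmetric] sum_sq_deviation[OF K, of \<mu> x, folded z_def]
    by (simp add: field_simps)
  finally show ?thesis .
qed

lemma normal_PiM_v1_theta_bar:
  fixes c \<sigma> :: "nat \<Rightarrow> real"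
  assumes \<sigma>: "\<And>i. i \<in> {1..K} \<Longrightarrow> 0 < \<sigma> i"
  shows "has_bochner_integral (\<Pi>\<^sub>M i\<in>{1..K}. lborel)
    (\<lambda>\<theta>. (\<Prod>i=1..K. normal_density (c i) (\<sigma> i) (\<theta> i)) * (A + d * v1 K \<theta> \<mu> + d' * (theta_bar K \<theta> - r)\<^sup>2))
    (A + d * (\<Sum>i=1..K. (\<sigma> i)\<^sup>2 + (c i - \<mu>)\<^sup>2)
      + d' * ((\<Sum>i=1..K. (1 / real K)\<^sup>2 * (\<sigma> i)\<^sup>2) + ((\<Sum>i=1..K. c i) / real K - r)\<^sup>2))"
proof -
  let ?L = "\<Pi>\<^sub>M i\<in>{1..K}. lborel :: real measure"
  define D where "D \<theta> = (\<Prod>i=1..K. normal_density (c i) (\<sigma> i) (\<theta> i))" for \<theta>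
  note S = normal_PiM_affine_square[of "{1..K}" \<sigma> c, OF finite_atLeastAtMost \<sigma>, folded D_def]
  \<comment> \<open>Zero weights and constant term 1 make the affine form identically 1, which gives
    the total mass.\<close>
  have 1: "has_bochner_integral ?L D 1"
    using S[of "\<lambda>_. 0" 1] by simp
  \<comment> \<open>Here the weights select the single coordinate \<open>i\<close>.\<close>
  have 2: "has_bochner_integral ?L (\<lambda>\<theta>. D \<theta> * (\<theta> i - \<mu>)\<^sup>2) ((\<sigma> i)\<^sup>2 + (c i - \<mu>)\<^sup>2)" if "i \<in> {1..K}" for i
    using S[of "\<lambda>j. if j = i then 1 else 0" "- \<mu>"] that
    by (simp add: if_distrib[of "\<lambda>x. x * _"] if_distrib[of "\<lambda>x. x\<^sup>2"] cong: if_cong)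
  have 3: "has_bochner_integral ?L (\<lambda>\<theta>. D \<theta> * (theta_bar K \<theta> - r)\<^sup>2)
      ((\<Sum>i=1..K. (1 / real K)\<^sup>2 * (\<sigma> i)\<^sup>2) + ((\<Sum>i=1..K. c i) / real K - r)\<^sup>2)"
    using S[of "\<lambda>_. 1 / real K" "- r"] by (simp add: theta_bar_def flip: sum_divide_distrib)
  have "has_bochner_integral ?L
      (\<lambda>\<theta>. A * D \<theta> + d * (\<Sum>i=1..K. D \<theta> * (\<theta> i - \<mu>)\<^sup>2) + d' * (D \<theta> * (theta_bar K \<theta> - r)\<^sup>2))
      (A * 1 + d * (\<Sum>i=1..K. (\<sigma> i)\<^sup>2 + (c i - \<mu>)\<^sup>2)
      + d' * ((\<Sum>i=1..K. (1 / real K)\<^sup>2 * (\<sigma> i)\<^sup>2) + ((\<Sum>i=1..K. c i) / real K - r)\<^sup>2))"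
    by (intro has_bochner_integral_add has_bochner_integral_mult_right has_bochner_integral_sum 1 2 3)
  moreover have "A * D \<theta> + d * (\<Sum>i=1..K. D \<theta> * (\<theta> i - \<mu>)\<^sup>2) + d' * (D \<theta> * (theta_bar K \<theta> - r)\<^sup>2)
      = D \<theta> * (A + d * v1 K \<theta> \<mu> + d' * (theta_bar K \<theta> - r)\<^sup>2)" for \<theta>
    by (simp add: v1_def sum_distrib_left algebra_simps)
  ultimately show ?thesis by (simp add: D_def)
qed

section \<open>Iterated integrals over the state space and measurability\<close>

lemma nn_integral_state_lebesgue:
  assumes f [measurable]: "f \<in> borel_measurable (state_lebesgue K)"
  shows "(\<integral>\<^sup>+ x. f x \<partial>state_lebesgue K) =
    (\<integral>\<^sup>+ \<mu>. \<integral>\<^sup>+ \<theta>. \<integral>\<^sup>+ l. \<integral>\<^sup>+ e. f (\<mu>, \<theta>, l, e) \<partial>lborel \<partial>lborel \<partial>(\<Pi>\<^sub>M i\<in>{1..K}. lborel) \<partial>lborel)"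
proof -
  let ?P = "\<Pi>\<^sub>M i\<in>{1..K}. lborel :: real measure" and ?L = "lborel :: real measure"
  interpret F: product_sigma_finite "\<lambda>i::nat. ?L" ..
  interpret P: sigma_finite_measure ?P by (intro F.sigma_finite) auto
  \<comment> \<open>Tonelli splits off one coordinate block at a time and asks for sigma-finiteness
    of the remaining product; this interpretation serves the first split.\<close>
  interpret PLL: pair_sigma_finite ?P "?L \<Otimes>\<^sub>M ?L" ..
  have [measurable]: "f \<in> borel_measurable (?L \<Otimes>\<^sub>M ?P \<Otimes>\<^sub>M ?L \<Otimes>\<^sub>M ?L)"
    using f by (simp add: state_lebesgue_def)
  have "(\<integral>\<^sup>+ x. f x \<partial>state_lebesgue K) = (\<integral>\<^sup>+ \<mu>. \<integral>\<^sup>+ z. f (\<mu>, z) \<partial>(?P \<Otimes>\<^sub>M ?L \<Otimes>\<^sub>M ?L) \<partial>?L)"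
    unfolding state_lebesgue_def by (rule PLL.nn_integral_fst[symmetric]) measurable
  also have "\<dots> = (\<integral>\<^sup>+ \<mu>. \<integral>\<^sup>+ \<theta>. \<integral>\<^sup>+ z. f (\<mu>, \<theta>, z) \<partial>(?L \<Otimes>\<^sub>M ?L) \<partial>?P \<partial>?L)"
    by (intro nn_integral_cong lborel_pair.nn_integral_fst[symmetric]) measurable
  also have "\<dots> = (\<integral>\<^sup>+ \<mu>. \<integral>\<^sup>+ \<theta>. \<integral>\<^sup>+ l. \<integral>\<^sup>+ e. f (\<mu>, \<theta>, l, e) \<partial>?L \<partial>?L \<partial>?P \<partial>?L)"
    by (intro nn_integral_cong lborel.nn_integral_fst[symmetric]) measurable
  finally show ?thesis .
qed

lemma measurable_PiM_lborel_component:
  assumes "f \<in> M \<rightarrow>\<^sub>M (\<Pi>\<^sub>M i\<in>I. lborel)" "i \<in> I"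
  shows "(\<lambda>x. f x i) \<in> borel_measurable M"
  using measurable_compose[OF assms(1) measurable_component_singleton[OF assms(2)]] by simp

lemma measurable_theta_bar [measurable]:
  assumes f: "f \<in> M \<rightarrow>\<^sub>M (\<Pi>\<^sub>M i\<in>{1..K}. lborel)"
  shows "(\<lambda>x. theta_bar K (f x)) \<in> borel_measurable M"
  supply measurable_PiM_lborel_component[OF f, measurable]
  unfolding theta_bar_def by measurable

lemma measurable_v1 [measurable]:
  assumes f: "f \<in> M \<rightarrow>\<^sub>M (\<Pi>\<^sub>M i\<in>{1..K}. lborel)" and [measurable]: "g \<in> borel_measurable M"
  shows "(\<lambda>x. v1 K (f x) (g x)) \<in> borel_measurable M"
  supply measurable_PiM_lborel_component[OF f, measurable]
  unfolding v1_def by measurable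

lemma measurable_v2 [measurable]:
  assumes f: "f \<in> M \<rightarrow>\<^sub>M (\<Pi>\<^sub>M i\<in>{1..K}. lborel)"
  shows "(\<lambda>x. v2 K m y (f x)) \<in> borel_measurable M"
  supply measurable_PiM_lborel_component[OF f, measurable]
  unfolding v2_def by measurable

lemma measurable_cond_theta_prod [measurable]:
  assumes f: "f \<in> M \<rightarrow>\<^sub>M (\<Pi>\<^sub>M i\<in>{1..K}. lborel)" and [measurable]: "g \<in> borel_measurable M"
  shows "(\<lambda>x. \<Prod>i=1..K. cond_theta m y i (g x) lam (f x i)) \<in> borel_measurable M"
  supply measurable_PiM_lborel_component[OF f, measurable]
  unfolding cond_theta_def case_prod_beta normal_density_def by measurable

lemma measurable_cond_mu [measurable]: "cond_mu s0 m0 K \<theta> lam \<in> borel_measurable borel"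
  unfolding cond_mu_def case_prod_beta by measurable

lemma measurable_gibbs_density [measurable]:
  "gibbs_density a1 b1 a2 b2 s0 m0 K m y x' \<in> borel_measurable (state_lebesgue K)"
  unfolding gibbs_density_def case_prod_beta state_lebesgue_def cond_lambda_theta_def cond_lambda_e_def
  by measurable

lemma measurable_V3 [measurable]:
  "(\<lambda>x. V3 c3 \<delta>1 \<delta>7 s0 K m y (fst (snd x)) (snd (snd x))) \<in> borel_measurable (state_lebesgue K)"
  unfolding V3_def case_prod_beta state_lebesgue_def by measurable

section \<open>Bounds for the individual conditional draws\<close>

lemma v1_nonneg: "0 \<le> v1 K \<theta> \<mu>"
  by (simp add: v1_def sum_nonneg)

lemma v2_nonneg: "0 \<le> v2 K m y \<theta>"
  by (simp add: v2_def sum_nonneg)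

lemma SSE_nonneg: "0 \<le> SSE K m y"
  by (simp add: SSE_def sum_nonneg)

lemma s_sq_nonneg: "0 \<le> s_sq K m y"
  by (simp add: s_sq_def sum_nonneg)

text \<open>The base decreases in the rate, so a rate depending on the state may be replaced by its
  lower bound \<open>b\<close>, giving a constant.\<close>

lemma gamma_mgf_bound:
  fixes b c \<beta> \<alpha> :: real
  assumes "0 < c" "c < b" "b \<le> \<beta>" "0 \<le> \<alpha>"
  shows "(\<beta> / (\<beta> - c)) powr \<alpha> \<le> (b / (b - c)) powr \<alpha>"
proof (rule powr_mono2)
  have "c * b \<le> c * \<beta>" using assms by simp
  then show "\<beta> / (\<beta> - c) \<le> b / (b - c)"
    using assms by (simp add: divide_simps) (simp add: algebra_simps)
qed (use assms in auto)

lemma lambda_update_bound: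
  fixes a1 b1 a2 b2 s0 c3 \<delta>7 :: real
  assumes pos: "0 < b1" "0 < a2" "0 < s0" "0 < K" "1 < a1" and c3: "0 < c3" "c3 < b1" "c3 < b2"
    and \<delta>1: "\<delta>1 = 1 / (2 * a1 + real K - 2)"
    and \<delta>6: "\<delta>6 = ((real K)\<^sup>2 + 2 * real K * a1) / (2 * s0 * b1 + (real K)\<^sup>2 + 2 * real K * a1)"
    and \<delta>7: "0 \<le> \<delta>7"
  shows "(\<integral>\<^sup>+ l. \<integral>\<^sup>+ e. ennreal (cond_lambda_theta a1 b1 K \<theta> \<mu> l * cond_lambda_e a2 b2 K m y \<theta> e
        * V3 c3 \<delta>1 \<delta>7 s0 K m y \<theta> (l, e)) \<partial>lborel \<partial>lborel)
    \<le> ennreal ((b1 / (b1 - c3)) powr (a1 + real K / 2)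
        + (b2 / (b2 - c3)) powr (a2 + real (M_total K m) / 2) + 2 * b1 * \<delta>7 / real K
        + \<delta>7 / real K * v1 K \<theta> \<mu> + \<delta>6 * (theta_bar K \<theta> - ybar K m y)\<^sup>2)"
proof -
  define \<alpha>1 \<alpha>2 \<beta>1 \<beta>2 where "\<alpha>1 = real K / 2 + a1" and "\<alpha>2 = real (M_total K m) / 2 + a2"
    and "\<beta>1 = v1 K \<theta> \<mu> / 2 + b1" and "\<beta>2 = (v2 K m y \<theta> + SSE K m y) / 2 + b2"
  note ab = \<alpha>1_def \<alpha>2_def \<beta>1_def \<beta>2_def
  define q where "q = (theta_bar K \<theta> - ybar K m y)\<^sup>2"
  have \<alpha>: "1 < \<alpha>1" "0 < \<alpha>2" using pos by (auto simp: ab add_nonneg_pos)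
  have \<beta>: "b1 \<le> \<beta>1" "b2 \<le> \<beta>2" using v1_nonneg v2_nonneg SSE_nonneg by (simp_all add: ab)
  have "0 < 2 * a1 + real K - 2" using pos by simp
  then have d1: "0 < \<delta>1" by (simp add: \<delta>1)
  have "(\<integral>\<^sup>+ l. \<integral>\<^sup>+ e. ennreal (gamma_density \<alpha>1 \<beta>1 l * gamma_density \<alpha>2 \<beta>2 e *
      (exp (c3 * l) + exp (c3 * e) + (\<delta>7 / (real K * \<delta>1)) / l + real K * l / (s0 + real K * l) * q)) \<partial>lborel \<partial>lborel)
    \<le> ennreal ((\<beta>1 / (\<beta>1 - c3)) powr \<alpha>1 + (\<beta>2 / (\<beta>2 - c3)) powr \<alpha>2 + \<delta>7 / (real K * \<delta>1) * (\<beta>1 / (\<alpha>1 - 1))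
        + real K * (\<alpha>1 / \<beta>1) / (s0 + real K * (\<alpha>1 / \<beta>1)) * q)"
    using \<alpha> \<beta> pos c3 d1 \<delta>7 by (intro gamma_update_bound) (auto simp: q_def)
  also have "\<dots> \<le> ennreal ((b1 / (b1 - c3)) powr \<alpha>1 + (b2 / (b2 - c3)) powr \<alpha>2
      + (2 * b1 * \<delta>7 / real K + \<delta>7 / real K * v1 K \<theta> \<mu>) + \<delta>6 * q)"
  proof (intro ennreal_leI add_mono gamma_mgf_bound mult_right_mono)
    \<comment> \<open>The shape satisfies \<open>\<alpha>1 - 1 = 1 / (2 * \<delta>1)\<close>. The
      resulting factor \<delta>1 cancels the one in the denominator of the third term of
      \<open>V3\<close>.\<close>
    have "\<beta>1 / (\<alpha>1 - 1) = \<delta>1 * (v1 K \<theta> \<mu> + 2 * b1)"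
      using pos by (simp add: ab \<delta>1 field_simps)
    then show "\<delta>7 / (real K * \<delta>1) * (\<beta>1 / (\<alpha>1 - 1)) \<le> 2 * b1 * \<delta>7 / real K + \<delta>7 / real K * v1 K \<theta> \<mu>"
      using d1 pos by (simp add: field_simps)
    have "real K * (\<alpha>1 / \<beta>1) \<le> real K * (\<alpha>1 / b1)"
      using pos \<alpha> \<beta> by (intro mult_left_mono divide_left_mono) auto
    then have "real K * (\<alpha>1 / \<beta>1) / (s0 + real K * (\<alpha>1 / \<beta>1)) \<le> real K * (\<alpha>1 / b1) / (s0 + real K * (\<alpha>1 / b1))"
      using pos \<alpha> \<beta> by (intro saturation_mono) auto
    \<comment> \<open>\<delta>6 is the saturating ratio at \<open>real K\<close> times the largest
      possible conditional mean of the precision, reached at the smallest rate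
      \<open>b1\<close>.\<close>
    also have "\<dots> = \<delta>6"
    proof -
      have "0 < real K * (2 * a1)" "0 < s0 * b1" using pos by auto
      then have "0 < s0 + real K * (\<alpha>1 / b1)" "0 < 2 * s0 * b1 + (real K)\<^sup>2 + 2 * real K * a1"
        using pos \<alpha> by (auto intro!: add_pos_nonneg)
      then show ?thesis unfolding \<delta>6
        using pos by (simp add: frac_eq_eq) (simp add: ab field_simps power2_eq_square)
    qed
    finally show "real K * (\<alpha>1 / \<beta>1) / (s0 + real K * (\<alpha>1 / \<beta>1)) \<le> \<delta>6" .
  qed (use \<alpha> \<beta> c3 in \<open>auto simp: q_def\<close>)
  finally show ?thesis
    by (simp add: cond_lambda_theta_def cond_lambda_e_def V3_def ab q_def add_ac)
qed

lemma theta_update_bound: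
  fixes d d' A p e :: real
  assumes K: "0 < K" and nn: "0 \<le> d" "0 \<le> d'" "0 \<le> A" and pe: "0 < p" "0 < e"
  shows "(\<integral>\<^sup>+ \<theta>. ennreal ((\<Prod>i=1..K. cond_theta m y i \<mu> (p, e) (\<theta> i)) *
      (A + d / real K * v1 K \<theta> \<mu> + d' * (theta_bar K \<theta> - ybar K m y)\<^sup>2)) \<partial>(\<Pi>\<^sub>M i\<in>{1..K}. lborel))
    \<le> ennreal (A + (d + d' / real K) / p + max d d' * s_sq K m y / real K + max d d' * (\<mu> - ybar K m y)\<^sup>2)"
proof -
  define t where "t i = p + real (m i) * e" for i
  have t: "0 < t i" "p \<le> t i" for i using pe by (simp_all add: t_def add_pos_nonneg)
  define c where "c i = (p * \<mu> + real (m i) * e * ybar_i m y i) / t i" for i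
  define \<sigma> where "\<sigma> i = sqrt (1 / t i)" for i
  have \<sigma>: "0 < \<sigma> i" "(\<sigma> i)\<^sup>2 = 1 / t i" for i using t[of i] by (simp_all add: \<sigma>_def)
  have th: "cond_theta m y i \<mu> (p, e) = normal_density (c i) (\<sigma> i)" for i
    by (simp add: cond_theta_def c_def \<sigma>_def t_def)
  have "(\<integral>\<^sup>+ \<theta>. ennreal ((\<Prod>i=1..K. cond_theta m y i \<mu> (p, e) (\<theta> i)) *
      (A + d / real K * v1 K \<theta> \<mu> + d' * (theta_bar K \<theta> - ybar K m y)\<^sup>2)) \<partial>(\<Pi>\<^sub>M i\<in>{1..K}. lborel))
    = ennreal (A + d / real K * (\<Sum>i=1..K. (\<sigma> i)\<^sup>2 + (c i - \<mu>)\<^sup>2)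
      + d' * ((\<Sum>i=1..K. (1 / real K)\<^sup>2 * (\<sigma> i)\<^sup>2) + ((\<Sum>i=1..K. c i) / real K - ybar K m y)\<^sup>2))"
    unfolding th using \<sigma> nn v1_nonneg
    by (intro nn_integral_has_bochner normal_PiM_v1_theta_bar)
      (auto intro!: mult_nonneg_nonneg add_nonneg_nonneg prod_nonneg normal_density_nonneg)
  also have "\<dots> \<le> ennreal (A + ((d + d' / real K) / p
      + max d d' * ((\<mu> - ybar K m y)\<^sup>2 + s_sq K m y / real K)))"
    unfolding ybar_def s_sq_def add.assoc
  proof (intro ennreal_leI add_left_mono theta_moment_bound[OF K nn(1,2) pe(1), unfolded add.assoc])
    fix i
    \<comment> \<open>The weight is the share of the data precision \<open>real (m i) * e\<close> in
      the total precision \<open>t i\<close>.\<close>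
    show "0 \<le> real (m i) * e / t i \<and> real (m i) * e / t i \<le> 1"
      using t[of i] pe by (simp add: t_def)
    show "(\<sigma> i)\<^sup>2 \<le> 1 / p" using t[of i] pe by (simp add: \<sigma> frac_le)
    have "1 - real (m i) * e / t i = p / t i"
      using t[of i] by (simp add: field_simps t_def)
    then show "c i = (1 - real (m i) * e / t i) * \<mu> + real (m i) * e / t i * ybar_i m y i"
      by (simp add: c_def add_divide_distrib)
  qed
  finally show ?thesis by (simp add: algebra_simps)
qed

text \<open>The conditional mean is a convex combination of \<open>m0\<close> and
  \<open>theta_bar K \<theta>\<close>, so convexity of the square applies. The weight
  \<open>w\<close> is kept because it reproduces the last term of \<open>V3\<close>.\<close>

lemma mu_update_bound:
  fixes K :: nat and A d r p s0 m0 :: real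
  assumes nn: "0 \<le> A" "0 \<le> d" and pos: "0 < s0" "0 < p"
  defines "w \<equiv> real K * p / (s0 + real K * p)"
  shows "(\<integral>\<^sup>+ \<mu>. ennreal (cond_mu s0 m0 K \<theta> (p, e) \<mu> * (A + d * (\<mu> - r)\<^sup>2)) \<partial>lborel)
    \<le> ennreal (A + d * (1 / s0 + (m0 - r)\<^sup>2) + d * (w * (theta_bar K \<theta> - r)\<^sup>2))"
proof -
  define t where "t = s0 + real K * p"
  have t: "0 < t" "s0 \<le> t" using pos by (simp_all add: t_def add_pos_nonneg)
  define c where "c = (s0 * m0 + real K * p * theta_bar K \<theta>) / t"
  have w: "0 \<le> w" "w \<le> 1" "1 - w = s0 / t" using t pos by (auto simp: w_def field_simps t_def)
  have "c - r = (1 - w) * (m0 - r) + w * (theta_bar K \<theta> - r)"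
  proof -
    have "c = (1 - w) * m0 + w * theta_bar K \<theta>"
      unfolding w(3) by (simp add: c_def w_def add_divide_distrib flip: t_def)
    then show ?thesis by (simp add: algebra_simps)
  qed
  also have "\<dots>\<^sup>2 \<le> (1 - w) * (m0 - r)\<^sup>2 + w * (theta_bar K \<theta> - r)\<^sup>2"
  proof -
    \<comment> \<open>This identity is the exact defect in Jensen's inequality for the
      square.\<close>
    have "(1 - w) * u\<^sup>2 + w * v\<^sup>2 - ((1 - w) * u + w * v)\<^sup>2 = w * (1 - w) * (u - v)\<^sup>2" for u v
      by (simp add: power2_eq_square algebra_simps)
    moreover have "0 \<le> w * (1 - w) * (u - v)\<^sup>2" for u v using w(1,2) by simp
    ultimately show ?thesis by (smt (verit, best))
  qed
  also have "\<dots> \<le> 1 * (m0 - r)\<^sup>2 + w * (theta_bar K \<theta> - r)\<^sup>2"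
    using w by (intro add_right_mono mult_right_mono) auto
  finally have c: "(c - r)\<^sup>2 \<le> (m0 - r)\<^sup>2 + w * (theta_bar K \<theta> - r)\<^sup>2" by simp
  have "(\<integral>\<^sup>+ \<mu>. ennreal (cond_mu s0 m0 K \<theta> (p, e) \<mu> * (A + d * (\<mu> - r)\<^sup>2)) \<partial>lborel)
      = ennreal (A + d * ((sqrt (1 / t))\<^sup>2 + (c - r)\<^sup>2))"
    unfolding cond_mu_def prod.case t_def[symmetric] c_def[symmetric] using t nn
    by (intro nn_integral_has_bochner normal_density_affine_square) (auto simp: normal_density_nonneg)
  also have "\<dots> \<le> ennreal (A + d * (1 / s0 + ((m0 - r)\<^sup>2 + w * (theta_bar K \<theta> - r)\<^sup>2)))"
    using t pos nn c by (intro ennreal_leI add_left_mono mult_left_mono add_mono) (auto simp: frac_le)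
  finally show ?thesis by (simp add: algebra_simps)
qed

section \<open>The drift inequality\<close>

lemma gibbs_kernel_nn_integral:
  "(\<integral>\<^sup>+ (\<mu>, \<theta>, lam). ennreal (V3 c3 \<delta>1 \<delta>7 s0 K m y \<theta> lam)
      \<partial>gibbs_kernel a1 b1 a2 b2 s0 m0 K m y (\<mu>', \<theta>', lam'))
    = (\<integral>\<^sup>+ \<mu>. \<integral>\<^sup>+ \<theta>. \<integral>\<^sup>+ l. \<integral>\<^sup>+ e.
        ennreal (gibbs_density a1 b1 a2 b2 s0 m0 K m y (\<mu>', \<theta>', lam') (\<mu>, \<theta>, l, e))
          * ennreal (V3 c3 \<delta>1 \<delta>7 s0 K m y \<theta> (l, e))
        \<partial>lborel \<partial>lborel \<partial>(\<Pi>\<^sub>M i\<in>{1..K}. lborel) \<partial>lborel)"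
proof -
  have [measurable]: "(\<lambda>x. ennreal (V3 c3 \<delta>1 \<delta>7 s0 K m y (fst (snd x)) (snd (snd x))))
      \<in> borel_measurable (state_lebesgue K)"
    by (rule measurable_compose[OF measurable_V3 measurable_ennreal])
  have [measurable]: "(\<lambda>x. ennreal (gibbs_density a1 b1 a2 b2 s0 m0 K m y (\<mu>', \<theta>', lam') x))
      \<in> borel_measurable (state_lebesgue K)"
    by (rule measurable_compose[OF measurable_gibbs_density measurable_ennreal])
  show ?thesis
    by (simp add: gibbs_kernel_def case_prod_beta nn_integral_density nn_integral_state_lebesgue)
qed

lemma cond_mu_nonneg: "0 \<le> cond_mu s0 m0 K \<theta> lam \<mu>"
  by (simp add: cond_mu_def case_prod_beta normal_density_nonneg)

lemma cond_theta_prod_nonneg: "0 \<le> (\<Prod>i=1..K. cond_theta m y i \<mu> lam (\<theta> i))"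
  by (simp add: cond_theta_def case_prod_beta normal_density_nonneg prod_nonneg)

lemma measurable_cond_lambda_theta [measurable]: "cond_lambda_theta a1 b1 K \<theta> \<mu> \<in> borel_measurable borel"
  unfolding cond_lambda_theta_def by measurable

lemma measurable_cond_lambda_e [measurable]: "cond_lambda_e a2 b2 K m y \<theta> \<in> borel_measurable borel"
  unfolding cond_lambda_e_def by measurable

text \<open>Chains the three update bounds from the inside out: each bound has the form of the
  integrand that the next one expects. Nonnegative integrals postpone all questions of
  integrability.\<close>

lemma gibbs_V3_bound:
  fixes a1 b1 a2 b2 s0 m0 c3 \<delta>7 :: real and m :: "nat \<Rightarrow> nat"
  assumes pos: "0 < b1" "0 < a2" "0 < s0" "0 < K" "1 < a1" and c3: "0 < c3" "c3 < b1" "c3 < b2"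
    and \<delta>1: "\<delta>1 = 1 / (2 * a1 + real K - 2)"
    and \<delta>6: "\<delta>6 = ((real K)\<^sup>2 + 2 * real K * a1) / (2 * s0 * b1 + (real K)\<^sup>2 + 2 * real K * a1)"
    and \<delta>7: "0 \<le> \<delta>7" and pe: "0 < p" "0 < e"
  defines "B \<equiv> (b1 / (b1 - c3)) powr (a1 + real K / 2)
      + (b2 / (b2 - c3)) powr (a2 + real (M_total K m) / 2) + 2 * b1 * \<delta>7 / real K"
  shows "(\<integral>\<^sup>+ (\<mu>, \<theta>, lam). ennreal (V3 c3 \<delta>1 \<delta>7 s0 K m y \<theta> lam)
      \<partial>gibbs_kernel a1 b1 a2 b2 s0 m0 K m y (\<mu>', \<theta>', p, e))
    \<le> ennreal (B + (\<delta>7 + \<delta>6 / real K) / p + max \<delta>7 \<delta>6 * s_sq K m y / real K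
        + max \<delta>7 \<delta>6 * (1 / s0 + (m0 - ybar K m y)\<^sup>2)
        + max \<delta>7 \<delta>6 * (real K * p / (s0 + real K * p) * (theta_bar K \<theta>' - ybar K m y)\<^sup>2))"
proof -
  let ?P = "\<Pi>\<^sub>M i\<in>{1..K}. lborel :: real measure"
  let ?n = "cond_mu s0 m0 K \<theta>' (p, e)" and ?D = "\<lambda>\<mu> \<theta>. \<Prod>i=1..K. cond_theta m y i \<mu> (p, e) (\<theta> i)"
  let ?g = "\<lambda>\<mu> \<theta> l e'. cond_lambda_theta a1 b1 K \<theta> \<mu> l * cond_lambda_e a2 b2 K m y \<theta> e'"
  let ?V = "\<lambda>\<theta> l e'. V3 c3 \<delta>1 \<delta>7 s0 K m y \<theta> (l, e')"
  let ?R = "\<lambda>\<mu> \<theta>. B + \<delta>7 / real K * v1 K \<theta> \<mu> + \<delta>6 * (theta_bar K \<theta> - ybar K m y)\<^sup>2"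
  let ?F = "\<lambda>\<mu>. (B + (\<delta>7 + \<delta>6 / real K) / p + max \<delta>7 \<delta>6 * s_sq K m y / real K) + max \<delta>7 \<delta>6 * (\<mu> - ybar K m y)\<^sup>2"
  have d6: "0 \<le> \<delta>6" using pos by (simp add: \<delta>6)
  have B: "0 \<le> B" using pos \<delta>7 by (simp add: B_def)
  have g: "0 \<le> ?g \<mu> \<theta> l e'" for \<mu> \<theta> l e'
    using pos by (simp add: cond_lambda_theta_def cond_lambda_e_def gamma_density_nonneg add_nonneg_pos)
  \<comment> \<open>\<open>?V\<close> may be negative off the state space. Pulling factors out of
    \<open>ennreal\<close> only asks the density factors to be nonnegative.\<close>
  have split: "ennreal (gibbs_density a1 b1 a2 b2 s0 m0 K m y (\<mu>', \<theta>', p, e) (\<mu>, \<theta>, l, e')) * ennreal (?V \<theta> l e')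
      = ennreal (?n \<mu>) * ennreal (?D \<mu> \<theta>) * ennreal (?g \<mu> \<theta> l e' * ?V \<theta> l e')" for \<mu> \<theta> l e'
    using cond_mu_nonneg[of s0 m0 K \<theta>' "(p, e)" \<mu>] cond_theta_prod_nonneg[of m y \<mu> "(p, e)" \<theta> K] g[of \<theta> \<mu> l e']
    by (simp add: gibbs_density_def mult.assoc flip: ennreal_mult')
  have lam: "(\<integral>\<^sup>+ l. \<integral>\<^sup>+ e'. ennreal (?n \<mu>) * ennreal (?D \<mu> \<theta>) * ennreal (?g \<mu> \<theta> l e' * ?V \<theta> l e') \<partial>lborel \<partial>lborel)
      \<le> ennreal (?n \<mu>) * ennreal (?D \<mu> \<theta> * ?R \<mu> \<theta>)" for \<mu> \<theta>
  proof -
    have "(\<integral>\<^sup>+ l. \<integral>\<^sup>+ e'. ennreal (?n \<mu>) * ennreal (?D \<mu> \<theta>) * ennreal (?g \<mu> \<theta> l e' * ?V \<theta> l e') \<partial>lborel \<partial>lborel)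
      = ennreal (?n \<mu>) * ennreal (?D \<mu> \<theta>) * (\<integral>\<^sup>+ l. \<integral>\<^sup>+ e'. ennreal (?g \<mu> \<theta> l e' * ?V \<theta> l e') \<partial>lborel \<partial>lborel)"
    proof -
      \<comment> \<open>Joint measurability is required, since the outer integrand is itself an
        integral over \<open>e'\<close>.\<close>
      have [measurable]: "(\<lambda>(l, e'). ?g \<mu> \<theta> l e' * ?V \<theta> l e') \<in> borel_measurable (borel \<Otimes>\<^sub>M borel)"
        unfolding V3_def prod.case by measurable
      have "(\<integral>\<^sup>+ e'. ennreal (?n \<mu>) * ennreal (?D \<mu> \<theta>) * ennreal (?g \<mu> \<theta> l e' * ?V \<theta> l e') \<partial>lborel)
          = ennreal (?n \<mu>) * ennreal (?D \<mu> \<theta>) * (\<integral>\<^sup>+ e'. ennreal (?g \<mu> \<theta> l e' * ?V \<theta> l e') \<partial>lborel)" for l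
        by (rule nn_integral_cmult) measurable
      then show ?thesis
        by (simp only:) (rule nn_integral_cmult, measurable)
    qed
    also have "\<dots> \<le> ennreal (?n \<mu>) * ennreal (?D \<mu> \<theta>) * ennreal (?R \<mu> \<theta>)"
      unfolding B_def using pos c3 \<delta>1 \<delta>6 \<delta>7 by (intro mult_left_mono lambda_update_bound) auto
    finally show ?thesis
      by (simp only: mult.assoc ennreal_mult'[OF cond_theta_prod_nonneg])
  qed
  have theta: "(\<integral>\<^sup>+ \<theta>. ennreal (?n \<mu>) * ennreal (?D \<mu> \<theta> * ?R \<mu> \<theta>) \<partial>?P) \<le> ennreal (?n \<mu> * ?F \<mu>)" for \<mu>
  proof -
    have "(\<integral>\<^sup>+ \<theta>. ennreal (?n \<mu>) * ennreal (?D \<mu> \<theta> * ?R \<mu> \<theta>) \<partial>?P)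
        = ennreal (?n \<mu>) * (\<integral>\<^sup>+ \<theta>. ennreal (?D \<mu> \<theta> * ?R \<mu> \<theta>) \<partial>?P)"
      by (rule nn_integral_cmult) measurable
    also have "\<dots> \<le> ennreal (?n \<mu>) * ennreal (?F \<mu>)"
      using pos d6 \<delta>7 B pe by (intro mult_left_mono theta_update_bound) auto
    finally show ?thesis by (simp add: cond_mu_nonneg flip: ennreal_mult')
  qed
  have "(\<integral>\<^sup>+ (\<mu>, \<theta>, lam). ennreal (V3 c3 \<delta>1 \<delta>7 s0 K m y \<theta> lam)
      \<partial>gibbs_kernel a1 b1 a2 b2 s0 m0 K m y (\<mu>', \<theta>', p, e))
    \<le> (\<integral>\<^sup>+ \<mu>. \<integral>\<^sup>+ \<theta>. ennreal (?n \<mu>) * ennreal (?D \<mu> \<theta> * ?R \<mu> \<theta>) \<partial>?P \<partial>lborel)"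
    unfolding gibbs_kernel_nn_integral split by (intro nn_integral_mono lam)
  also have "\<dots> \<le> (\<integral>\<^sup>+ \<mu>. ennreal (?n \<mu> * ?F \<mu>) \<partial>lborel)"
    by (intro nn_integral_mono theta)
  also have "\<dots> \<le> ennreal ((B + (\<delta>7 + \<delta>6 / real K) / p + max \<delta>7 \<delta>6 * s_sq K m y / real K)
        + max \<delta>7 \<delta>6 * (1 / s0 + (m0 - ybar K m y)\<^sup>2)
        + max \<delta>7 \<delta>6 * (real K * p / (s0 + real K * p) * (theta_bar K \<theta>' - ybar K m y)\<^sup>2))"
    using pos d6 \<delta>7 B pe s_sq_nonneg by (intro mu_update_bound) (auto simp: le_max_iff_disj)
  finally show ?thesis .
qed

section \<open>From nonnegative integrals to the expectation\<close>

lemma integrable_nn_bound: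
  fixes f :: "'a \<Rightarrow> real"
  assumes "f \<in> borel_measurable M" "AE x in M. 0 \<le> f x" "(\<integral>\<^sup>+ x. ennreal (f x) \<partial>M) \<le> ennreal r" "0 \<le> r"
  shows "integrable M f \<and> integral\<^sup>L M f \<le> r"
proof
  show int: "integrable M f"
    using assms by (intro integrableI_nonneg) (auto simp: top_unique less_top[symmetric])
  have "ennreal (integral\<^sup>L M f) \<le> ennreal r"
    using assms by (simp add: nn_integral_eq_integral[OF int])
  then show "integral\<^sup>L M f \<le> r" using assms by simp
qed

text \<open>The reference measure also charges nonpositive precisions, where \<open>V3\<close> may
  be negative, but the Gamma factor removes them from the kernel. Hence the \<open>ennreal\<close>
  integral does not truncate the expectation.\<close>

lemma AE_gibbs_kernel_V3_nonneg:
  assumes "0 < s0" "0 < \<delta>1" "0 \<le> \<delta>7"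
  shows "AE x in gibbs_kernel a1 b1 a2 b2 s0 m0 K m y x'. 0 \<le> (\<lambda>(\<mu>, \<theta>, lam). V3 c3 \<delta>1 \<delta>7 s0 K m y \<theta> lam) x"
proof -
  have "0 \<le> V3 c3 \<delta>1 \<delta>7 s0 K m y \<theta> (l, e)"
    if "0 < gibbs_density a1 b1 a2 b2 s0 m0 K m y x' (\<mu>, \<theta>, l, e)" for \<mu> \<theta> l e
  proof -
    have "0 < l" using that
      by (rule_tac ccontr) (simp add: gibbs_density_def case_prod_beta cond_lambda_theta_def gamma_density_def)
    then show ?thesis
      using assms by (auto simp: V3_def intro!: add_nonneg_nonneg mult_nonneg_nonneg divide_nonneg_nonneg)
  qed
  then show ?thesis
    unfolding gibbs_kernel_def by (subst AE_density) (auto intro: measurable_compose[OF measurable_gibbs_density measurable_ennreal])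
qed

theorem proposition5p1:
  fixes K :: nat and m :: "nat \<Rightarrow> nat" and y :: "nat \<Rightarrow> nat \<Rightarrow> real"
    and a1 b1 a2 b2 s0 m0 \<delta>1 \<delta>6 \<delta>7 \<rho>1 c3 \<gamma> b :: real
    and m' m'' :: nat
  assumes "\<forall>i\<in>{1..K}. m i > 0"
    and "a1 > 0" "b1 > 0" "a2 > 0" "b2 > 0" "s0 > 0"
    and "K \<ge> 3"
    and "m' = Min (m ` {1..K})" and "m' \<ge> 2"
    and "m'' = Max (m ` {1..K})"
    and "a1 > 3 / 2"
    and "\<delta>1 = 1 / (2 * a1 + real K - 2)"
    and "\<delta>6 = ((real K)\<^sup>2 + 2 * real K * a1) / (2 * s0 * b1 + (real K)\<^sup>2 + 2 * real K * a1)"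
    and "\<delta>7 = 1 / (2 * (a1 - 1))"
    and "\<rho>1 \<in> {0<..<1}"
    and "(real K + \<delta>6 / \<delta>7) * \<delta>1 < \<rho>1"
    and "5 * m' > m''"
    and "c3 \<in> {0<..<min b1 b2}"
    and "\<gamma> \<in> {Max {\<rho>1, \<delta>6, \<delta>7}<..<1}"
    and "b = (b1 / (b1 - c3)) powr (a1 + real K / 2)
           + (b2 / (b2 - c3)) powr (a2 + real (M_total K m) / 2)
           + (\<delta>6 + \<delta>7) * (1 / s0 + (m0 - ybar K m y)\<^sup>2 + s_sq K m y / real K)
           + 2 * b1 * \<delta>7 / real K"
  shows "\<forall>(\<mu>', \<theta>', lam')\<in>state_space K.
           integrable (gibbs_kernel a1 b1 a2 b2 s0 m0 K m y (\<mu>', \<theta>', lam'))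
             (\<lambda>(\<mu>, \<theta>, lam). V3 c3 \<delta>1 \<delta>7 s0 K m y \<theta> lam)
         \<and> (\<integral>(\<mu>, \<theta>, lam). V3 c3 \<delta>1 \<delta>7 s0 K m y \<theta> lam
              \<partial>gibbs_kernel a1 b1 a2 b2 s0 m0 K m y (\<mu>', \<theta>', lam'))
           \<le> \<gamma> * V3 c3 \<delta>1 \<delta>7 s0 K m y \<theta>' lam' + b"
proof -
  \<comment> \<open>\<open>d\<close> is the factor passed on by the squared means. It is at most
    \<gamma>, for contraction, and at most \<open>\<delta>6 + \<delta>7\<close>, for the constant
    \<open>b\<close>.\<close>
  define d where "d = max \<delta>7 \<delta>6"
  have K: "0 < K" "1 < a1" "0 < 2 * a1 + real K - 2" using assms(7,11) by simp_all
  have \<delta>: "0 < \<delta>1" "0 < \<delta>7" "0 \<le> \<delta>6" using assms K by simp_all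
  have d: "0 \<le> d" "d \<le> \<delta>6 + \<delta>7" "d \<le> \<gamma>" "\<rho>1 \<le> \<gamma>" "0 < \<gamma>"
    using assms(15,19) \<delta> by (auto simp: d_def)
  have c3: "0 < c3" "c3 < b1" "c3 < b2" using assms(18) by auto
  define S where "S = 1 / s0 + (m0 - ybar K m y)\<^sup>2 + s_sq K m y / real K"
  have S: "0 \<le> S" using assms(6) s_sq_nonneg[of K m y] by (simp add: S_def)
  define B where "B = (b1 / (b1 - c3)) powr (a1 + real K / 2)
      + (b2 / (b2 - c3)) powr (a2 + real (M_total K m) / 2) + 2 * b1 * \<delta>7 / real K"
  have B: "0 \<le> B" using assms(3) \<delta> by (simp add: B_def)
  have b: "b = B + (\<delta>6 + \<delta>7) * S" by (simp add: assms(20) B_def S_def)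
  have "integrable (gibbs_kernel a1 b1 a2 b2 s0 m0 K m y (\<mu>', \<theta>', p, e))
             (\<lambda>(\<mu>, \<theta>, lam). V3 c3 \<delta>1 \<delta>7 s0 K m y \<theta> lam)
         \<and> (\<integral>(\<mu>, \<theta>, lam). V3 c3 \<delta>1 \<delta>7 s0 K m y \<theta> lam
              \<partial>gibbs_kernel a1 b1 a2 b2 s0 m0 K m y (\<mu>', \<theta>', p, e))
           \<le> \<gamma> * V3 c3 \<delta>1 \<delta>7 s0 K m y \<theta>' (p, e) + b"
    if pe: "0 < p" "0 < e" for \<mu>' \<theta>' p e
  proof (rule integrable_nn_bound)
    define Q where "Q = real K * p / (s0 + real K * p) * (theta_bar K \<theta>' - ybar K m y)\<^sup>2"
    have Q: "0 \<le> Q" using pe assms(6) by (simp add: Q_def)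
    \<comment> \<open>The variance contribution is rewritten as a multiple of the third term of
      \<open>V3\<close> at the current state; the prefactor lies below \<open>\<rho>1\<close>, hence
      below \<gamma>.\<close>
    have "(\<delta>7 + \<delta>6 / real K) / p = (real K + \<delta>6 / \<delta>7) * \<delta>1 * (\<delta>7 / (real K * \<delta>1 * p))"
      using \<delta> K pe by (simp add: field_simps)
    also have "\<dots> \<le> \<gamma> * (\<delta>7 / (real K * \<delta>1 * p))"
      using assms(16) d \<delta> pe by (intro mult_right_mono) auto
    finally have inv: "(\<delta>7 + \<delta>6 / real K) / p \<le> \<gamma> * (\<delta>7 / (real K * \<delta>1 * p))" .
    \<comment> \<open>The new exponential terms are already bounded by constants in
      \<open>B\<close>, so the current ones enter the right-hand side as nonnegative slack.\<close>
    have "0 \<le> \<gamma> * (exp (c3 * p) + exp (c3 * e))" using d by simp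
    with inv have "B + (\<delta>7 + \<delta>6 / real K) / p + d * S + d * Q
      \<le> B + (\<gamma> * (exp (c3 * p) + exp (c3 * e)) + \<gamma> * (\<delta>7 / (real K * \<delta>1 * p))) + (\<delta>6 + \<delta>7) * S + \<gamma> * Q"
      using d S Q by (intro add_mono mult_right_mono) linarith+
    also have "\<dots> = \<gamma> * V3 c3 \<delta>1 \<delta>7 s0 K m y \<theta>' (p, e) + b"
      by (simp add: V3_def Q_def b algebra_simps)
    finally have num: "B + (\<delta>7 + \<delta>6 / real K) / p + d * S + d * Q
      \<le> \<gamma> * V3 c3 \<delta>1 \<delta>7 s0 K m y \<theta>' (p, e) + b" .
    have "0 \<le> B + (\<delta>7 + \<delta>6 / real K) / p + d * S + d * Q"
      using B S Q d \<delta> pe by simp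
    with num show "0 \<le> \<gamma> * V3 c3 \<delta>1 \<delta>7 s0 K m y \<theta>' (p, e) + b" by simp
    have "(\<integral>\<^sup>+ (\<mu>, \<theta>, lam). ennreal (V3 c3 \<delta>1 \<delta>7 s0 K m y \<theta> lam)
        \<partial>gibbs_kernel a1 b1 a2 b2 s0 m0 K m y (\<mu>', \<theta>', p, e))
      \<le> ennreal (B + (\<delta>7 + \<delta>6 / real K) / p + d * S + d * Q)"
      using gibbs_V3_bound[OF assms(3,4,6) K(1,2) c3 assms(12,13) less_imp_le[OF \<delta>(2)] pe, where m = m and y = y and ?m0.0 = m0 and \<mu>' = \<mu>'
            and \<theta>' = \<theta>']
      by (simp add: B_def d_def S_def Q_def algebra_simps)
    also have "\<dots> \<le> ennreal (\<gamma> * V3 c3 \<delta>1 \<delta>7 s0 K m y \<theta>' (p, e) + b)"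
      using num by (rule ennreal_leI)
    finally show "(\<integral>\<^sup>+ x. ennreal ((\<lambda>(\<mu>, \<theta>, lam). V3 c3 \<delta>1 \<delta>7 s0 K m y \<theta> lam) x)
        \<partial>gibbs_kernel a1 b1 a2 b2 s0 m0 K m y (\<mu>', \<theta>', p, e)) \<le> ennreal (\<gamma> * V3 c3 \<delta>1 \<delta>7 s0 K m y \<theta>' (p, e) + b)"
      by (simp add: case_prod_unfold)
  qed (use AE_gibbs_kernel_V3_nonneg[OF assms(6) \<delta>(1) less_imp_le[OF \<delta>(2)]] in \<open>auto simp: gibbs_kernel_def case_prod_unfold\<close>)
  then show ?thesis by (auto simp: state_space_def)
qed

end
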